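(* Let $n\ge 2$ and $1\le p\le n-1$. Let $\Delta=\{e_i-e_j\mid 1\le i\ne j\le n\}$ (type $A_{n-1}$) and $$\Delta^a=\{e_i-e_j\mid 1\le i\ne j\le p\}\cup\{e_i-e_j\mid p+1\le i\ne j\le n\}$$ (type $A_{p-1}\times A_{n-p-1}$). Put $\Gamma=\{e_i-e_j\mid 1\le i\ne j\le n-1\}\subset\Delta$, $\Gamma^a=\Gamma\cap\Delta^a$, and $$\tilde\Gamma=\{e_i-e_j\mid 1\le i\ne j\le p-1\}\cup\{e_i-e_j\mid p\le i\ne j\le n-1\}.$$ Then $$\mathcal W(\Delta)/\mathcal W(\Delta^a)=\mathcal W(\Gamma)/\mathcal W(\Gamma^a)\ \cup\ \left\{w\,s_{e_{n-1}-e_n}s_{e_{n-2}-e_{n-1}}\cdots s_{e_p-e_{p+1}}\ \middle|\ w\in\mathcal W(\Gamma)/\mathcal W(\tilde\Gamma)\right\},$$ in the sense that, whenever the quotients on the right-hand side are replaced by complete systems of representatives of $\mathcal W(\Gamma)/\mathcal W(\Gamma^a)$ and of $\mathcal W(\Gamma)/\mathcal W(\tilde\Gamma)$, the right-hand side is a complete system of representatives for $\mathcal W(\Delta)/\mathcal W(\Delta^a)$.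
   Context: $e_1,\dots,e_n$ is the standard orthonormal basis. $s_\lambda$ denotes the reflection along the hyperplane orthogonal to (the kernel of) the root $\lambda$; thus $s_{e_i-e_j}$ acts as the transposition exchanging $e_i$ and $e_j$. For a root system $\Lambda$ (possibly empty), $\mathcal W(\Lambda)$ is the group generated by all $s_\lambda$, $\lambda\in\Lambda$ (the trivial group if $\Lambda=\emptyset$); all these groups are regarded as subgroups of $\mathcal W(\Delta)$, the full permutation group of $e_1,\dots,e_n$. Products of reflections are compositions of maps (rightmost applied first). For a subgroup $V$ of a group $W$, $W/V$ is the set of cosets $wV$, so that $w,w'$ represent the same class iff $w^{-1}w'\in V$; quotients are identified in the formula with complete systems of representatives. *)

theory Defs
  imports "HOL-Analysis.Analysis" "HOL-Algebra.Bij" "HOL-Algebra.Left_Coset"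
    "HOL-Algebra.Generated_Groups"
begin

definition refl_along :: "'a::real_inner \<Rightarrow> 'a \<Rightarrow> 'a" where
  "refl_along l x = x - (2 * (x \<bullet> l) / (l \<bullet> l)) *\<^sub>R l"

(* Multiplication in BijGroup UNIV is composition of maps, the right factor being applied first.
   As every refl_along l is a bijection, the intersection with the carrier that is built into
   subgroup_generated discards no generator. *)
definition weyl_group :: "'a::real_inner set \<Rightarrow> ('a \<Rightarrow> 'a) monoid" where
  "weyl_group L = subgroup_generated (BijGroup UNIV) (refl_along ` L)"

definition roots_A :: "(nat \<Rightarrow> 'a::real_inner) \<Rightarrow> nat set \<Rightarrow> 'a set" where
  "roots_A e I = {e i - e j | i j. i \<in> I \<and> j \<in> I \<and> i \<noteq> j}"

definition complete_reps :: "('a, 'b) monoid_scheme \<Rightarrow> 'a set \<Rightarrow> 'a set \<Rightarrow> bool" where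
  "complete_reps W V R \<longleftrightarrow> R \<subseteq> carrier W \<and> (\<forall>C \<in> lcosets\<^bsub>W\<^esub> V. \<exists>!r. r \<in> R \<and> r \<in> C)"

(* s_{e_{n-1} - e_n} o s_{e_{n-2} - e_{n-1}} o ... o s_{e_p - e_{p+1}} *)
definition refl_chain :: "(nat \<Rightarrow> 'a::real_inner) \<Rightarrow> nat \<Rightarrow> nat \<Rightarrow> 'a \<Rightarrow> 'a" where
  "refl_chain e p n = foldr (\<circ>) (map (\<lambda>i. refl_along (e i - e (i + 1))) (rev [p..<n])) id"

end

theory Submission
  imports Defs
begin

text \<open>
  A permutation of the coordinates lies in the left coset of \<open>w\<close> modulo the stabilizer of
  \<open>{e 1, \<dots>, e p}\<close> iff it sends this set to the same set as \<open>w\<close>. Hence the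
  cosets of all three quotients correspond to sets of basis vectors: those of
  \<open>\<W>(\<Delta>)/\<W>(\<Delta>a)\<close> to the \<open>p\<close>-subsets of \<open>{1..n}\<close>, those of
  \<open>\<W>(\<Gamma>)/\<W>(\<Gamma>a)\<close> to the \<open>p\<close>-subsets of \<open>{1..n-1}\<close>, and those of
  \<open>\<W>(\<Gamma>)/\<W>(\<Gamma>t)\<close> to the \<open>(p-1)\<close>-subsets of \<open>{1..n-1}\<close>. The chain of
  reflections is a cycle sending \<open>{1..p}\<close> to \<open>{1..p-1} \<union> {n}\<close>, so the union on the right
  separates the \<open>p\<close>-subsets of \<open>{1..n}\<close> according to whether they contain \<open>n\<close>.
\<close>

section \<open>Bijections under composition, and permutations with a prescribed image\<close>

lemma carrier_BijGroup_UNIV: "f \<in> carrier (BijGroup UNIV) \<longleftrightarrow> bij f"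
  by (simp add: BijGroup_def Bij_def)

lemma one_BijGroup_UNIV: "\<one>\<^bsub>BijGroup UNIV\<^esub> = id"
  by (simp add: BijGroup_def id_def restrict_def)

lemma mult_BijGroup_UNIV: "bij f \<Longrightarrow> bij g \<Longrightarrow> f \<otimes>\<^bsub>BijGroup UNIV\<^esub> g = f \<circ> g"
  by (simp add: BijGroup_def Bij_def compose_def comp_def restrict_def)

lemma mult_weyl_group: "bij f \<Longrightarrow> bij g \<Longrightarrow> f \<otimes>\<^bsub>weyl_group L\<^esub> g = f \<circ> g"
  by (simp add: weyl_group_def subgroup_generated_def mult_BijGroup_UNIV)

text \<open>The complements in \<open>K\<close> also have equal size, so a bijection from
  \<open>I\<close> to \<open>X\<close> and one between the complements glue together. This
  transitivity makes every subset of the right size the label of a coset.\<close>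

lemma ex_permutes_image_eq:
  assumes "finite K" "I \<subseteq> K" "X \<subseteq> K" "card X = card I"
  obtains q where "q permutes K" "q ` I = X"
proof -
  have fin: "finite I" "finite X" "finite (K - I)" "finite (K - X)"
    using assms finite_subset by auto
  have "card (K - I) = card (K - X)"
    using assms fin by (simp add: card_Diff_subset)
  then obtain f g where f: "bij_betw f I X" and g: "bij_betw g (K - I) (K - X)"
    using assms(4) fin by (metis finite_same_card_bij)
  define q where "q i = (if i \<in> I then f i else if i \<in> K then g i else i)" for i
  have q1: "bij_betw q I X"
    using f by (rule bij_betw_cong[THEN iffD1, rotated]) (simp add: q_def)
  have q2: "bij_betw q (K - I) (K - X)"
    using g by (rule bij_betw_cong[THEN iffD1, rotated]) (simp add: q_def)
  have "bij_betw q (I \<union> (K - I)) (X \<union> (K - X))"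
    using q1 q2 by (rule bij_betw_combine) blast
  then have "bij_betw q K K"
    using assms(2,3) by (simp add: Un_absorb1)
  then have "q permutes K"
    by (rule bij_imp_permutes) (use assms(2) in \<open>auto simp: q_def\<close>)
  with q1 show thesis
    by (auto intro: that simp: bij_betw_def)
qed

section \<open>Permutations of an orthonormal basis as linear maps\<close>

locale indexed_basis =
  fixes e :: "nat \<Rightarrow> 'a::euclidean_space" and N :: "nat set"
  assumes bij_e: "bij_betw e N Basis"
begin

text \<open>Given as a sum over \<open>N\<close>, the map is linear for every index function
  \<open>q\<close>. A permutation of a subset of \<open>N\<close>, being the identity elsewhere,
  needs no separate encoding.\<close>

definition coord_perm :: "(nat \<Rightarrow> nat) \<Rightarrow> 'a \<Rightarrow> 'a" where
  "coord_perm q x = (\<Sum>i\<in>N. (x \<bullet> e i) *\<^sub>R e (q i))"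

lemma finite_N: "finite N"
  using bij_betw_finite[OF bij_e] by simp

lemma inj_on_e: "inj_on e N"
  using bij_e by (simp add: bij_betw_def)

lemma inner_e: "i \<in> N \<Longrightarrow> j \<in> N \<Longrightarrow> e i \<bullet> e j = (if i = j then 1 else 0)"
  using bij_betwE[OF bij_e] inj_on_eq_iff[OF inj_on_e] by (auto simp: inner_not_same_Basis)

lemma image_e_eq_iff: "A \<subseteq> N \<Longrightarrow> B \<subseteq> N \<Longrightarrow> e ` A = e ` B \<longleftrightarrow> A = B"
  using inj_on_e by (rule inj_on_image_eq_iff)

lemma linear_eqI:
  assumes "linear f" "linear g" "\<And>i. i \<in> N \<Longrightarrow> f (e i) = g (e i)"
  shows "f = g"
proof (rule linear_eq_stdbasis[OF assms(1,2)])
  fix b :: 'a assume "b \<in> Basis"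
  then obtain i where "i \<in> N" "b = e i"
    using bij_e by (auto simp: bij_betw_def)
  with assms(3) show "f b = g b" by simp
qed

lemma linear_coord_perm: "linear (coord_perm q)"
  unfolding coord_perm_def
  by (intro linearI)
    (simp_all add: inner_add_left scaleR_add_left sum.distrib scaleR_sum_right)

lemma coord_perm_e: "i \<in> N \<Longrightarrow> coord_perm q (e i) = e (q i)"
  by (simp add: coord_perm_def inner_e finite_N if_distrib[of "\<lambda>c. c *\<^sub>R _"] cong: if_cong)

lemma coord_perm_image: "A \<subseteq> N \<Longrightarrow> coord_perm q ` e ` A = e ` q ` A"
  by (force simp: coord_perm_e image_iff subset_iff)

text \<open>Both sides are linear, so basis vectors suffice; the hypothesis keeps
  \<open>q' i\<close> in \<open>N\<close>, where \<open>coord_perm_e\<close> evaluates the outer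
  map.\<close>

lemma coord_perm_comp:
  assumes "q' ` N \<subseteq> N"
  shows "coord_perm (q \<circ> q') = coord_perm q \<circ> coord_perm q'"
  by (rule linear_eqI) (use assms in \<open>auto simp: linear_coord_perm linear_compose coord_perm_e image_subset_iff\<close>)

lemma coord_perm_id: "coord_perm id = id"
  by (rule linear_eqI) (auto simp: linear_coord_perm linear_id coord_perm_e)

lemma linear_refl_along: "linear (refl_along l)"
  unfolding refl_along_def
  by (intro linearI)
    (simp_all add: inner_add_left algebra_simps add_divide_distrib)

text \<open>The root has squared length 2, so the reflection subtracts exactly the difference of the
  two coordinates times the root, which swaps them.\<close>

lemma refl_along_eq_coord_perm:
  assumes "i \<in> N" "j \<in> N" "i \<noteq> j"
  shows "refl_along (e i - e j) = coord_perm (Transposition.transpose i j)"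
  by (rule linear_eqI)
    (use assms in \<open>auto simp: linear_refl_along linear_coord_perm coord_perm_e refl_along_def
      inner_diff_left inner_diff_right inner_e transpose_def\<close>)

lemma bij_coord_perm:
  assumes "q permutes N"
  shows "bij (coord_perm q)"
proof (rule o_bij)
  have q': "inv_into UNIV q permutes N"
    using assms by (rule permutes_inv)
  show "coord_perm (inv_into UNIV q) \<circ> coord_perm q = id"
    using assms by (simp flip: coord_perm_comp add: permutes_image permutes_inv_o coord_perm_id)
  show "coord_perm q \<circ> coord_perm (inv_into UNIV q) = id"
    using assms q' by (simp flip: coord_perm_comp add: permutes_image permutes_inv_o coord_perm_id)
qed

section \<open>Weyl groups of type A as groups of coordinate permutations\<close>

lemma refl_along_in_carrier:
  assumes "i \<in> N" "j \<in> N" "i \<noteq> j"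
  shows "refl_along (e i - e j) \<in> carrier (BijGroup UNIV)"
  using assms
  by (simp add: carrier_BijGroup_UNIV refl_along_eq_coord_perm bij_coord_perm permutes_swap_id)

text \<open>\<open>generate\<close> also admits inverses of generators; since reflections are
  involutions, this adds nothing new.\<close>

lemma inv_refl_along:
  assumes "i \<in> N" "j \<in> N" "i \<noteq> j"
  shows "inv\<^bsub>BijGroup UNIV\<^esub> refl_along (e i - e j) = refl_along (e i - e j)"
proof (rule group.inv_equality[OF group_BijGroup])
  have "coord_perm (Transposition.transpose i j) \<circ> coord_perm (Transposition.transpose i j) = id"
    using assms
    by (simp flip: coord_perm_comp add: permutes_image[OF permutes_swap_id] coord_perm_id)
  then show "refl_along (e i - e j) \<otimes>\<^bsub>BijGroup UNIV\<^esub> refl_along (e i - e j) = \<one>\<^bsub>BijGroup UNIV\<^esub>"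
    using assms refl_along_in_carrier[OF assms]
    by (simp add: mult_BijGroup_UNIV one_BijGroup_UNIV carrier_BijGroup_UNIV refl_along_eq_coord_perm)
qed (use assms refl_along_in_carrier in auto)

text \<open>Permutations of a finite set are products of transpositions, and each transposition
  within \<open>I\<close> is a reflection from \<open>L\<close>. Allowing a larger \<open>L\<close>
  lets the lemma serve either block of a union of root systems.\<close>

lemma coord_perm_in_weyl_group:
  assumes "roots_A e I \<subseteq> L" "I \<subseteq> N" "q permutes I"
  shows "coord_perm q \<in> carrier (weyl_group L)"
  using assms(3) finite_subset[OF assms(2) finite_N]
proof (induction rule: permutes_induct)
  case id
  show ?case
    unfolding weyl_group_def carrier_subgroup_generated coord_perm_id
    by (rule generate.one[of "BijGroup UNIV", unfolded one_BijGroup_UNIV])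
next
  case (swap i j q)
  have ij: "i \<in> N" "j \<in> N"
    using swap assms(2) by auto
  have q: "q permutes N"
    using swap assms(2) permutes_subset by blast
  have t: "Transposition.transpose i j permutes N"
    using ij by (simp add: permutes_swap_id)
  have "e i - e j \<in> L"
    using swap assms(1) by (auto simp: roots_A_def)
  then have "coord_perm (Transposition.transpose i j) \<in> carrier (weyl_group L)"
    using ij swap refl_along_in_carrier[of i j]
    by (auto simp: weyl_group_def carrier_subgroup_generated
        simp flip: refl_along_eq_coord_perm intro!: generate.incl)
  with swap have "coord_perm (Transposition.transpose i j) \<otimes>\<^bsub>BijGroup UNIV\<^esub> coord_perm q \<in> carrier (weyl_group L)"
    by (simp add: weyl_group_def carrier_subgroup_generated generate.eng)
  moreover have "q ` N \<subseteq> N"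
    using q by (simp add: permutes_image)
  ultimately show ?case
    using q t by (simp only: mult_BijGroup_UNIV bij_coord_perm coord_perm_comp)
qed

text \<open>This is the Young subgroup of the two blocks, described as the setwise stabilizer of
  \<open>I\<close>. The generators stabilize \<open>I\<close>; conversely, a stabilizing permutation
  splits into one permutation for each block.\<close>

lemma carrier_weyl_group_roots_A_Un:
  assumes "I \<subseteq> K" "K \<subseteq> N"
  shows "carrier (weyl_group (roots_A e I \<union> roots_A e (K - I))) =
    coord_perm ` {q. q permutes K \<and> q ` I = I}"
    (is "carrier (weyl_group ?L) = coord_perm ` ?Q")
proof (intro equalityI subsetI)
  have Q_perm: "q permutes N" if "q \<in> ?Q" for q
    using that assms permutes_subset by blast
  have refl_Q: "f \<in> coord_perm ` ?Q \<and> inv\<^bsub>BijGroup UNIV\<^esub> f \<in> coord_perm ` ?Q"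
    if f: "f \<in> refl_along ` ?L" for f
  proof -
    obtain i j where ij: "f = refl_along (e i - e j)" "i \<noteq> j"
      and mem: "i \<in> I \<and> j \<in> I \<or> i \<in> K - I \<and> j \<in> K - I"
      using f by (auto simp: roots_A_def)
    have "i \<in> N" "j \<in> N"
      using mem assms by auto
    moreover have "Transposition.transpose i j ` I = I"
      using mem
    proof
      assume "i \<in> I \<and> j \<in> I"
      then show ?thesis by (simp add: permutes_image permutes_swap_id)
    next
      assume "i \<in> K - I \<and> j \<in> K - I"
      then have "Transposition.transpose i j ` I = id ` I"
        by (intro image_cong refl) (auto simp: Transposition.transpose_def)
      then show ?thesis by simp
    qed
    then have "Transposition.transpose i j \<in> ?Q"
      using mem assms(1) by (auto intro: permutes_swap_id)
    ultimately show ?thesis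
      using ij(2) unfolding ij(1)
      by (metis (no_types, lifting) image_eqI inv_refl_along refl_along_eq_coord_perm)
  qed
  fix f assume "f \<in> carrier (weyl_group ?L)"
  then have "f \<in> generate (BijGroup UNIV) (carrier (BijGroup UNIV) \<inter> refl_along ` ?L)"
    by (simp add: weyl_group_def carrier_subgroup_generated)
  then show "f \<in> coord_perm ` ?Q"
  proof (induction rule: generate.induct)
    case one
    have "id \<in> ?Q" by (simp add: permutes_id)
    then show ?case
      by (metis (no_types, lifting) coord_perm_id image_eqI one_BijGroup_UNIV)
  next
    case (eng f g)
    then obtain q r where q: "q \<in> ?Q" "f = coord_perm q" and r: "r \<in> ?Q" "g = coord_perm r"
      by blast
    then have "f \<otimes>\<^bsub>BijGroup UNIV\<^esub> g = coord_perm (q \<circ> r)"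
      using Q_perm by (simp add: mult_BijGroup_UNIV bij_coord_perm coord_perm_comp permutes_image)
    moreover have "q \<circ> r \<in> ?Q"
      using q(1) r(1) by (metis (mono_tags, lifting) image_comp mem_Collect_eq permutes_compose)
    ultimately show ?case by blast
  qed (use refl_Q in auto)
next
  fix f assume "f \<in> coord_perm ` ?Q"
  then obtain q where q: "q permutes K" "q ` I = I" and f: "f = coord_perm q"
    by blast
  have inj: "inj q"
    using q(1) by (rule permutes_inj)
  have "q ` (K - I) = K - I"
    using q inj by (simp add: image_set_diff permutes_image)
  \<comment> \<open>Each factor follows \<open>q\<close> on its own block and is the identity
    elsewhere. The supports are disjoint, so the composition of the two is \<open>q\<close>.\<close>
  then have a: "restrict_id q I permutes I" and b: "restrict_id q (K - I) permutes (K - I)"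
    using q inj_on_subset[OF inj subset_UNIV] by (auto intro!: permutes_restrict_id simp: bij_betw_def)
  have "q = restrict_id q I \<circ> restrict_id q (K - I)"
    using q \<open>q ` (K - I) = K - I\<close> assms(1)
    by (auto simp: fun_eq_iff restrict_id_def permutes_def)
  moreover have aN: "restrict_id q I permutes N" and bN: "restrict_id q (K - I) permutes N"
    using a b assms by (auto intro: permutes_subset)
  ultimately have "f = coord_perm (restrict_id q I) \<otimes>\<^bsub>BijGroup UNIV\<^esub> coord_perm (restrict_id q (K - I))"
    using f by (metis bij_coord_perm coord_perm_comp mult_BijGroup_UNIV order_refl permutes_image)
  moreover have "coord_perm (restrict_id q I) \<in> carrier (weyl_group ?L)"
    using a assms by (intro coord_perm_in_weyl_group[of I]) auto
  moreover have "coord_perm (restrict_id q (K - I)) \<in> carrier (weyl_group ?L)"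
    using b assms by (intro coord_perm_in_weyl_group[of "K - I"]) auto
  ultimately show "f \<in> carrier (weyl_group ?L)"
    by (simp add: weyl_group_def carrier_subgroup_generated generate.eng)
qed

text \<open>Taking the first block empty makes the stabilizer condition vacuous.\<close>

lemma carrier_weyl_group_roots_A:
  assumes "K \<subseteq> N"
  shows "carrier (weyl_group (roots_A e K)) = coord_perm ` {q. q permutes K}"
  using carrier_weyl_group_roots_A_Un[of "{}" K] assms by (simp add: roots_A_def)

section \<open>Cosets as fibres of the action on sets of basis vectors\<close>

lemma l_coset_weyl_group:
  assumes "I \<subseteq> K" "K \<subseteq> N" "q permutes K"
  shows "coord_perm q <#\<^bsub>weyl_group L\<^esub> carrier (weyl_group (roots_A e I \<union> roots_A e (K - I))) =
    {f \<in> carrier (weyl_group (roots_A e K)). f ` e ` I = e ` q ` I}" (is "?l = ?r")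
proof (intro equalityI subsetI)
  have perm_N: "r permutes N" if "r permutes K" for r
    using that assms(2) permutes_subset by blast
  have IN: "I \<subseteq> N" using assms by blast
  {
    fix f assume "f \<in> ?l"
    then obtain r where r: "r permutes K" "r ` I = I"
      and f: "f = coord_perm q \<otimes>\<^bsub>weyl_group L\<^esub> coord_perm r"
      using assms by (auto simp: l_coset_def carrier_weyl_group_roots_A_Un)
    then have f_eq: "f = coord_perm (q \<circ> r)"
      using assms(3) perm_N
      by (simp add: mult_weyl_group bij_coord_perm coord_perm_comp permutes_image)
    moreover have "(q \<circ> r) ` I = q ` I"
      by (simp only: image_comp[symmetric] r(2))
    ultimately show "f \<in> ?r"
      using r(1) assms IN
      by (auto simp: carrier_weyl_group_roots_A permutes_compose coord_perm_image simp del: comp_apply)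
  next
    fix f assume "f \<in> ?r"
    then obtain r where r: "r permutes K" and f: "f = coord_perm r" and img: "e ` r ` I = e ` q ` I"
      using assms IN by (auto simp: carrier_weyl_group_roots_A coord_perm_image)
    have "r ` I \<subseteq> N" "q ` I \<subseteq> N"
      using IN permutes_image[OF perm_N] r assms(3) by blast+
    then have rq: "r ` I = q ` I"
      using img by (simp add: image_e_eq_iff)
    \<comment> \<open>The quotient of \<open>r\<close> by \<open>q\<close> from the left; equality
      of the two images of \<open>I\<close> says precisely that \<open>h\<close> stabilizes
      \<open>I\<close>.\<close>
    define h where "h = inv_into UNIV q \<circ> r"
    have h: "h permutes K"
      using r assms(3) by (simp add: h_def permutes_compose permutes_inv)
    moreover have "h ` I = I"
      unfolding h_def image_comp[symmetric] rq
      by (simp only: image_comp permutes_inv_o[OF assms(3)] image_id id_apply)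
    ultimately have "coord_perm h \<in> carrier (weyl_group (roots_A e I \<union> roots_A e (K - I)))"
      using assms by (auto simp: carrier_weyl_group_roots_A_Un)
    moreover have "f = coord_perm (q \<circ> h)"
      unfolding f h_def o_assoc permutes_inv_o(1)[OF assms(3)] by simp
    then have "f = coord_perm q \<otimes>\<^bsub>weyl_group L\<^esub> coord_perm h"
      using assms(3) h perm_N
      by (simp add: mult_weyl_group bij_coord_perm coord_perm_comp permutes_image)
    ultimately show "f \<in> ?l"
      by (auto simp: l_coset_def)
  }
qed

text \<open>Replaces cosets by their labels: the coset of \<open>q\<close> is the fibre over the
  image of \<open>I\<close> under \<open>q\<close>, and these images are exactly the subsets of
  \<open>K\<close> of size \<open>card I\<close>. The theorem then becomes a statement about
  subsets.\<close>

lemma complete_reps_iff: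
  assumes "I \<subseteq> K" "K \<subseteq> N"
  shows "complete_reps (weyl_group (roots_A e K))
      (carrier (weyl_group (roots_A e I \<union> roots_A e (K - I)))) R \<longleftrightarrow>
    R \<subseteq> coord_perm ` {q. q permutes K} \<and>
    (\<forall>X. X \<subseteq> K \<and> card X = card I \<longrightarrow> (\<exists>!r. r \<in> R \<and> r ` e ` I = e ` X))"
proof -
  let ?W = "weyl_group (roots_A e K)"
  let ?V = "carrier (weyl_group (roots_A e I \<union> roots_A e (K - I)))"
  define C where "C X = {f \<in> carrier ?W. f ` e ` I = e ` X}" for X
  have "lcosets\<^bsub>?W\<^esub> ?V = (\<lambda>q. C (q ` I)) ` {q. q permutes K}"
    using assms
    by (auto simp: LCOSETS_def carrier_weyl_group_roots_A l_coset_weyl_group C_def)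
  also have "\<dots> = C ` (\<lambda>q. q ` I) ` {q. q permutes K}"
    by (simp add: image_image)
  also have "(\<lambda>q. q ` I) ` {q. q permutes K} = {X. X \<subseteq> K \<and> card X = card I}"
  proof (intro equalityI subsetI)
    fix X assume "X \<in> {X. X \<subseteq> K \<and> card X = card I}"
    then show "X \<in> (\<lambda>q. q ` I) ` {q. q permutes K}"
      using ex_permutes_image_eq[of K I X] assms finite_subset[OF _ finite_N]
      by (smt (verit) image_eqI mem_Collect_eq)
  next
    fix X assume "X \<in> (\<lambda>q. q ` I) ` {q. q permutes K}"
    then obtain q where q: "q permutes K" "X = q ` I"
      by blast
    have "card X = card I"
      unfolding q(2) using permutes_inj_on[OF q(1)] by (rule card_image)
    moreover have "X \<subseteq> K"
      using q assms(1) permutes_image[OF q(1)] by blast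
    ultimately show "X \<in> {X. X \<subseteq> K \<and> card X = card I}"
      by simp
  qed
  finally have *: "lcosets\<^bsub>?W\<^esub> ?V = C ` {X. X \<subseteq> K \<and> card X = card I}" .
  have "complete_reps ?W ?V R \<longleftrightarrow> R \<subseteq> carrier ?W \<and>
    (\<forall>X. X \<subseteq> K \<and> card X = card I \<longrightarrow> (\<exists>!r. r \<in> R \<and> r \<in> C X))"
    by (simp add: complete_reps_def *)
  also have "\<dots> \<longleftrightarrow> R \<subseteq> carrier ?W \<and>
    (\<forall>X. X \<subseteq> K \<and> card X = card I \<longrightarrow> (\<exists>!r. r \<in> R \<and> r ` e ` I = e ` X))"
  \<comment> \<open>Inside the carrier, lying in the fibre \<open>C X\<close> is just the condition
    on the image; otherwise both sides are false.\<close>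
  proof (cases "R \<subseteq> carrier ?W")
    case True
    then have "r \<in> R \<and> r \<in> C X \<longleftrightarrow> r \<in> R \<and> r ` e ` I = e ` X" for r X
      by (auto simp: C_def)
    then show ?thesis by simp
  qed simp
  finally show ?thesis
    using assms(2) by (simp add: carrier_weyl_group_roots_A)
qed

section \<open>The chain of reflections as a cycle, and intersections of root systems\<close>

lemma refl_chain_eq_coord_perm:
  assumes "p \<le> m" "{p..m} \<subseteq> N"
  obtains c where "c permutes {p..m}" "c p = m" "refl_chain e p m = coord_perm c"
  using assms
proof (induction m arbitrary: thesis rule: dec_induct)
  case base
  show ?case
  \<comment> \<open>For equal end points the chain is an empty composition.\<close>
  proof (rule base(1))
    show "id permutes {p..p}" "id p = p"
      by simp_all
    show "refl_chain e p p = coord_perm id"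
      unfolding coord_perm_id by (simp add: refl_chain_def)
  qed
next
  case (step m)
  have sub: "{p..m} \<subseteq> N"
    using step.prems by (auto simp: subset_iff)
  obtain c where c: "c permutes {p..m}" "c p = m" "refl_chain e p m = coord_perm c"
    using step.IH sub by blast
  have mN: "m \<in> N" "Suc m \<in> N"
    using step by auto
  \<comment> \<open>The list of indices is reversed, so the new reflection stands leftmost and acts
    last, carrying \<open>m\<close> on to \<open>Suc m\<close>.\<close>
  have "refl_chain e p (Suc m) = refl_along (e m - e (Suc m)) \<circ> refl_chain e p m"
    using step by (simp add: refl_chain_def)
  also have "\<dots> = coord_perm (Transposition.transpose m (Suc m) \<circ> c)"
    using c permutes_subset[OF c(1) sub] mN
    by (simp add: refl_along_eq_coord_perm coord_perm_comp permutes_image)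
  finally have *: "refl_chain e p (Suc m) = coord_perm (Transposition.transpose m (Suc m) \<circ> c)" .
  have "c permutes {p..Suc m}"
    using c(1) by (rule permutes_subset) auto
  then have "Transposition.transpose m (Suc m) \<circ> c permutes {p..Suc m}"
    using step by (intro permutes_compose permutes_swap_id) auto
  then show ?case
    by (rule step.prems(1)[OF _ _ *]) (simp add: c)
qed

text \<open>A root determines its ordered pair of indices, so a common root has both indices in both
  sets. This turns the intersection defining \<open>\<Gamma>a\<close> into a union of two
  blocks.\<close>

lemma roots_A_Int:
  assumes "I \<subseteq> N" "J \<subseteq> N"
  shows "roots_A e I \<inter> roots_A e J = roots_A e (I \<inter> J)"
proof (intro equalityI subsetI)
  fix x assume "x \<in> roots_A e I \<inter> roots_A e J"
  then have "x \<in> roots_A e I" "x \<in> roots_A e J"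
    by auto
  then obtain i j k l where x: "x = e i - e j" "i \<in> I" "j \<in> I" "i \<noteq> j"
    and x': "x = e k - e l" "k \<in> J" "l \<in> J" "k \<noteq> l"
    unfolding roots_A_def by blast
  have N: "i \<in> N" "j \<in> N" "k \<in> N" "l \<in> N"
    using x x' assms by auto
  \<comment> \<open>These inner products are 1 and -1 on the left, which forces \<open>k\<close> and
    \<open>l\<close> on the right.\<close>
  have "(e i - e j) \<bullet> e i = (e k - e l) \<bullet> e i" "(e i - e j) \<bullet> e j = (e k - e l) \<bullet> e j"
    using x(1) x'(1) by auto
  then have "i = k" "j = l"
    using N x(4) by (auto simp: inner_diff_left inner_e split: if_splits)
  with x x' show "x \<in> roots_A e (I \<inter> J)"
    by (auto simp: roots_A_def)
qed (auto simp: roots_A_def)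

end

section \<open>Splitting the quotient by membership of the last index\<close>

theorem proposition3p1:
  fixes e :: "nat \<Rightarrow> real ^ 'n"
    and n p :: nat
    and \<Delta> \<Delta>a \<Gamma> \<Gamma>a \<Gamma>t :: "(real ^ 'n) set"
    and R S :: "(real ^ 'n \<Rightarrow> real ^ 'n) set"
  assumes "n = CARD('n)"
    and "n \<ge> 2"
    and "1 \<le> p" and "p \<le> n - 1"
    and "bij_betw e {1..n} Basis"
    and "\<Delta> = roots_A e {1..n}"
    and "\<Delta>a = roots_A e {1..p} \<union> roots_A e {p+1..n}"
    and "\<Gamma> = roots_A e {1..n-1}"
    and "\<Gamma>a = \<Gamma> \<inter> \<Delta>a"
    and "\<Gamma>t = roots_A e {1..p-1} \<union> roots_A e {p..n-1}"
    and "complete_reps (weyl_group \<Gamma>) (carrier (weyl_group \<Gamma>a)) R"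
    and "complete_reps (weyl_group \<Gamma>) (carrier (weyl_group \<Gamma>t)) S"
  shows "complete_reps (weyl_group \<Delta>) (carrier (weyl_group \<Delta>a))
           (R \<union> {w \<circ> refl_chain e p n | w. w \<in> S})"
proof -
  interpret indexed_basis e "{1..n}"
    by unfold_locales (fact assms(5))
  have reps_iff: "complete_reps (weyl_group \<Delta>) (carrier (weyl_group \<Delta>a)) T \<longleftrightarrow>
    T \<subseteq> coord_perm ` {q. q permutes {1..n}} \<and>
    (\<forall>X. X \<subseteq> {1..n} \<and> card X = p \<longrightarrow> (\<exists>!r. r \<in> T \<and> r ` e ` {1..p} = e ` X))" for T
  proof -
    have "{1..n} - {1..p} = {p+1..n}" by auto
    moreover have "p \<le> n"
      using assms(4) by simp
    ultimately show ?thesis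
      using complete_reps_iff[of "{1..p}" "{1..n}" T] by (simp add: assms(6,7))
  qed
  have R: "R \<subseteq> coord_perm ` {q. q permutes {1..n-1}}"
    "\<And>X. X \<subseteq> {1..n-1} \<Longrightarrow> card X = p \<Longrightarrow> \<exists>!r. r \<in> R \<and> r ` e ` {1..p} = e ` X"
  proof -
    \<comment> \<open>As \<open>p\<close> is at most \<open>n-1\<close>, the first block survives
      whole; the second loses \<open>n\<close> and is empty when \<open>p = n-1\<close>.\<close>
    have eqs: "{1..n-1} \<inter> {1..p} = {1..p}" "{1..n-1} \<inter> {p+1..n} = {1..n-1} - {1..p}"
      using assms(2-4) by auto
    have "\<Gamma>a = roots_A e ({1..n-1} \<inter> {1..p}) \<union> roots_A e ({1..n-1} \<inter> {p+1..n})"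
      unfolding assms(7-9) Int_Un_distrib using assms(2-4)
      by (intro arg_cong2[of _ _ _ _ "(\<union>)"] roots_A_Int) auto
    then have "\<Gamma>a = roots_A e {1..p} \<union> roots_A e ({1..n-1} - {1..p})"
      by (simp only: eqs)
    then show "R \<subseteq> coord_perm ` {q. q permutes {1..n-1}}"
      "\<And>X. X \<subseteq> {1..n-1} \<Longrightarrow> card X = p \<Longrightarrow> \<exists>!r. r \<in> R \<and> r ` e ` {1..p} = e ` X"
      using complete_reps_iff[of "{1..p}" "{1..n-1}" R] assms(2-4,8,11) by auto
  qed
  have S: "S \<subseteq> coord_perm ` {q. q permutes {1..n-1}}"
    "\<And>X. X \<subseteq> {1..n-1} \<Longrightarrow> card X = p - 1 \<Longrightarrow> \<exists>!r. r \<in> S \<and> r ` e ` {1..p-1} = e ` X"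
  proof -
    \<comment> \<open>For \<open>p = 1\<close> the first block is empty and the only label is the
      empty set.\<close>
    have sub: "{1..p-1} \<subseteq> {1..n-1}" "{1..n-1} \<subseteq> {1..n}"
      using assms(4) by auto
    have "{1..n-1} - {1..p-1} = {p..n-1}"
      using assms(3) by auto
    then show "S \<subseteq> coord_perm ` {q. q permutes {1..n-1}}"
      "\<And>X. X \<subseteq> {1..n-1} \<Longrightarrow> card X = p - 1 \<Longrightarrow> \<exists>!r. r \<in> S \<and> r ` e ` {1..p-1} = e ` X"
      using complete_reps_iff[OF sub, of S] assms(8,10,12) by auto
  qed
  obtain c where c: "c permutes {p..n}" "c p = n" "refl_chain e p n = coord_perm c"
    by (rule refl_chain_eq_coord_perm[of p n]) (use assms(2-4) in auto)
  have cN: "c permutes {1..n}"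
    using c(1) by (rule permutes_subset) (use assms(3) in auto)
  have "{1..p} = insert p {1..p-1}"
    using assms(3) by auto
  moreover have "c ` {1..p-1} = id ` {1..p-1}"
  proof (intro image_cong refl)
    fix x assume "x \<in> {1..p-1}"
    then have "x \<notin> {p..n}" by auto
    then show "c x = id x"
      using permutes_not_in[OF c(1)] by simp
  qed
  \<comment> \<open>Only the value at \<open>p\<close> and the fixed points below \<open>p\<close>
    matter for this image.\<close>
  ultimately have c_img: "c ` {1..p} = insert n {1..p-1}"
    using c(2) by simp
  have perm_n: "q permutes {1..n}" "q n = n" if "q permutes {1..n-1}" for q
    using that assms(2) permutes_subset[OF that, of "{1..n}"] by (auto simp: permutes_not_in)
  have insert_n: "{1..n} = insert n {1..n-1}" "n \<notin> {1..n-1}"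
    using assms(2) by auto
  have R_img: "\<exists>Y \<subseteq> {1..n-1}. r ` e ` {1..p} = e ` Y" if r: "r \<in> R" for r
  proof -
    obtain q where q: "q permutes {1..n-1}" "r = coord_perm q"
      using R(1) r by blast
    have "q ` {1..p} \<subseteq> q ` {1..n-1}"
      using assms(4) by (intro image_mono) auto
    moreover have "r ` e ` {1..p} = e ` q ` {1..p}"
      unfolding q(2) using assms(4) by (intro coord_perm_image) auto
    ultimately show ?thesis
      using q(1) by (metis permutes_image)
  qed
  \<comment> \<open>The chain acts first and brings \<open>n\<close> into the set; \<open>w\<close>
    then fixes \<open>n\<close> and moves the other \<open>p-1\<close> indices within
    \<open>{1..n-1}\<close>.\<close>
  have S_img: "\<exists>Y \<subseteq> {1..n-1}. w ` e ` {1..p-1} = e ` Y \<and>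
      (w \<circ> refl_chain e p n) ` e ` {1..p} = e ` insert n Y" if w: "w \<in> S" for w
  proof -
    obtain q where q: "q permutes {1..n-1}" "w = coord_perm q"
      using S(1) w by blast
    have "w \<circ> refl_chain e p n = coord_perm (q \<circ> c)"
      unfolding q(2) c(3) by (rule coord_perm_comp[symmetric]) (simp only: permutes_image[OF cN] order_refl)
    moreover have "(q \<circ> c) ` {1..p} = insert n (q ` {1..p-1})"
      using perm_n(2)[OF q(1)] c_img by (simp only: image_comp[symmetric] image_insert)
    ultimately have "(w \<circ> refl_chain e p n) ` e ` {1..p} = e ` insert n (q ` {1..p-1})"
      using coord_perm_image[of "{1..p}" "q \<circ> c"] assms(4) by fastforce
    moreover have "w ` e ` {1..p-1} = e ` q ` {1..p-1}"
      unfolding q(2) using assms(4) by (intro coord_perm_image) auto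
    moreover have "q ` {1..p-1} \<subseteq> q ` {1..n-1}"
      using assms(4) by (intro image_mono) auto
    ultimately show ?thesis
      using q(1) by (metis permutes_image)
  qed
  have uniq: "\<exists>!r. r \<in> R \<union> {w \<circ> refl_chain e p n | w. w \<in> S} \<and> r ` e ` {1..p} = e ` X"
    if X: "X \<subseteq> {1..n}" "card X = p" for X
  proof (cases "n \<in> X")
    case False
    then have X': "X \<subseteq> {1..n-1}"
      using X(1) unfolding insert_n(1) by blast
    \<comment> \<open>Every image coming from \<open>S\<close> contains the vector of index
      \<open>n\<close>, so for this \<open>X\<close> only \<open>R\<close> can supply a
      representative.\<close>
    have "(w \<circ> refl_chain e p n) ` e ` {1..p} \<noteq> e ` X" if w: "w \<in> S" for w
    proof -
      obtain Y where Y: "Y \<subseteq> {1..n-1}" "(w \<circ> refl_chain e p n) ` e ` {1..p} = e ` insert n Y"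
        using S_img[OF w] by blast
      have "insert n Y \<subseteq> {1..n}"
        using Y(1) unfolding insert_n(1) by blast
      then show ?thesis
        unfolding Y(2) using X(1) False by (subst image_e_eq_iff) auto
    qed
    then have "r \<in> R \<union> {w \<circ> refl_chain e p n | w. w \<in> S} \<and> r ` e ` {1..p} = e ` X \<longleftrightarrow>
        r \<in> R \<and> r ` e ` {1..p} = e ` X" for r
      by blast
    then show ?thesis
      using R(2)[OF X' X(2)] by simp
  next
    case True
    define Y where "Y = X - {n}"
    have "Y \<subseteq> {1..n-1}"
      using X(1) unfolding Y_def insert_n(1) by blast
    with True X(2) have Y: "Y \<subseteq> {1..n-1}" "X = insert n Y" "n \<notin> Y" "card Y = p - 1"
      by (auto simp: Y_def)
    have notR: "r ` e ` {1..p} \<noteq> e ` X" if r: "r \<in> R" for r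
    proof -
      obtain Z where Z: "Z \<subseteq> {1..n-1}" "r ` e ` {1..p} = e ` Z"
        using R_img[OF r] by blast
      have "Z \<subseteq> {1..n}" "n \<notin> Z"
        using Z(1) insert_n(2) unfolding insert_n(1) by blast+
      then show ?thesis
        unfolding Z(2) using X(1) True by (subst image_e_eq_iff) auto
    qed
    \<comment> \<open>Cancelling \<open>n\<close> from both sets turns the condition on the
      \<open>p\<close>-subset \<open>X\<close> into the one on the \<open>(p-1)\<close>-subset
      \<open>Y\<close> that governs \<open>S\<close>.\<close>
    have iff: "(w \<circ> refl_chain e p n) ` e ` {1..p} = e ` X \<longleftrightarrow> w ` e ` {1..p-1} = e ` Y"
      if w: "w \<in> S" for w
    proof -
      obtain Z where Z: "Z \<subseteq> {1..n-1}" "w ` e ` {1..p-1} = e ` Z"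
        "(w \<circ> refl_chain e p n) ` e ` {1..p} = e ` insert n Z"
        using S_img[OF w] by blast
      have sub: "Z \<subseteq> {1..n}" "insert n Z \<subseteq> {1..n}" "Y \<subseteq> {1..n}" "n \<notin> Z"
        using Z(1) Y(1) insert_n(2) unfolding insert_n(1) by blast+
      show ?thesis
        unfolding Z(2,3) image_e_eq_iff[OF sub(2) X(1)] image_e_eq_iff[OF sub(1,3)]
        unfolding Y(2) using sub(4) Y(3) by (rule insert_ident)
    qed
    obtain w where w: "w \<in> S" "w ` e ` {1..p-1} = e ` Y"
      "\<And>v. v \<in> S \<Longrightarrow> v ` e ` {1..p-1} = e ` Y \<Longrightarrow> v = w"
      using S(2)[OF Y(1,4)] by metis
    show ?thesis
    proof (rule ex1I[of _ "w \<circ> refl_chain e p n"])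
      show "w \<circ> refl_chain e p n \<in> R \<union> {w \<circ> refl_chain e p n | w. w \<in> S} \<and>
          (w \<circ> refl_chain e p n) ` e ` {1..p} = e ` X"
        unfolding iff[OF w(1)] using w(1,2) by blast
    next
      fix r assume r: "r \<in> R \<union> {w \<circ> refl_chain e p n | w. w \<in> S} \<and> r ` e ` {1..p} = e ` X"
      then have "r \<notin> R"
        by (meson notR)
      with r obtain v where v: "v \<in> S" "r = v \<circ> refl_chain e p n"
        by blast
      \<comment> \<open>Uniqueness is inherited from \<open>S\<close>: the factor \<open>v\<close>
        has the same label \<open>Y\<close> as \<open>w\<close>.\<close>
      have "v ` e ` {1..p-1} = e ` Y"
        using r unfolding v(2) iff[OF v(1)] by (rule conjunct2)
      with v w(3) show "r = w \<circ> refl_chain e p n"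
        by (simp only:)
    qed
  qed
  \<comment> \<open>With unique representatives settled, it remains that both sets lie in the Weyl
    group of \<open>\<Delta>\<close>.\<close>
  have R_perm: "R \<subseteq> coord_perm ` {q. q permutes {1..n}}"
    using R(1) perm_n(1) by blast
  have S_perm: "w \<circ> refl_chain e p n \<in> coord_perm ` {q. q permutes {1..n}}" if w: "w \<in> S" for w
  proof -
    obtain q where q: "q permutes {1..n-1}" "w = coord_perm q"
      using S(1) w by blast
    have "w \<circ> refl_chain e p n = coord_perm (q \<circ> c)"
      unfolding q(2) c(3) by (rule coord_perm_comp[symmetric]) (simp only: permutes_image[OF cN] order_refl)
    moreover have "q \<circ> c permutes {1..n}"
      using cN perm_n(1)[OF q(1)] by (rule permutes_compose)
    ultimately show ?thesis by blast
  qed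
  show ?thesis
    unfolding reps_iff
  proof (intro conjI allI impI Un_least R_perm)
    show "{w \<circ> refl_chain e p n | w. w \<in> S} \<subseteq> coord_perm ` {q. q permutes {1..n}}"
      by (rule subsetI, elim CollectE exE conjE) (simp only: S_perm)
  qed (elim conjE, rule uniq)
qed

end
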